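(* Let $\alpha\in\mathbb{C}\setminus\{1\}$, $a_{12},a_{23}\in\mathbb{C}$, $r_1=a_{12}(e_1\otimes e_2-e_2\otimes e_1)$, $r_2=a_{23}(e_2\otimes e_3-e_3\otimes e_2)$, and for $t\in\{1,2\}$ let $\Delta_t(x)=(\mathrm{id}\otimes L(x)-R(x)\otimes\mathrm{id})r_t$ for $x\in\mathcal{H}_\alpha$. Let $e_1^*,e_2^*,e_3^*$ be the dual basis of the dual space $\mathcal{H}_\alpha^*$. Then the dual map $\Delta_t^*:\mathcal{H}_\alpha^*\otimes\mathcal{H}_\alpha^*\to\mathcal{H}_\alpha^*$ of $\Delta_t$ is an associative algebra product $\circ$ on $\mathcal{H}_\alpha^*$, given for $i,j\in\{1,2,3\}$ by $$e_i^*\circ e_j^*=-\delta_{i2}\delta_{j2}(\alpha+1)a_{12}\,e_3^*\quad\text{for } t=1,$$ $$e_i^*\circ e_j^*=\delta_{i2}\delta_{j2}(\alpha+1)a_{23}\,e_1^*\quad\text{for } t=2 .$$ Moreover, $(\mathcal{H}_\alpha,\mathcal{H}_\alpha^*,R^*_\cdot,L^*_\cdot,R^*_\circ,L^*_\circ)$ is a matched pair of associative algebras.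
   Context: $\mathcal{H}_\alpha$ is the complex associative algebra with basis $e_1,e_2,e_3$ and product $e_1\cdot e_3=e_2$, $e_3\cdot e_1=\alpha e_2$, all other products of basis vectors zero. $L(x)y=x\cdot y$, $R(x)y=y\cdot x$. The dual map is $\langle \Delta_t^*(a^*\otimes b^* ),x\rangle=\langle a^*\otimes b^*,\Delta_t(x)\rangle$. For an associative algebra $(\mathcal{A},\cdot)$, the maps $L^*_\cdot,R^*_\cdot:\mathcal{A}\to\mathfrak{gl}(\mathcal{A}^* )$ are $(L^*_\cdot(x)u^* )(v)=u^*(x\cdot v)$ and $(R^*_\cdot(x)u^* )(v)=u^*(v\cdot x)$. Likewise, for a product $\circ$ on $\mathcal{A}^*$ (with $\mathcal{A}$ finite dimensional and $\mathcal{A}^{**}=\mathcal{A}$), $L^*_\circ,R^*_\circ:\mathcal{A}^*\to\mathfrak{gl}(\mathcal{A})$ are $\langle L^*_\circ(a^* )x,b^*\rangle=\langle x,a^*\circ b^*\rangle$ and $\langle R^*_\circ(a^* )x,b^*\rangle=\langle x,b^*\circ a^*\rangle$. A bimodule $(l,r,V)$ of an associative algebra $\mathcal{A}$ consists of linear maps $l,r:\mathcal{A}\to\mathfrak{gl}(V)$ with $l(xy)=l(x)l(y)$, $r(xy)=r(y)r(x)$, $l(x)r(y)=r(y)l(x)$. For associative algebras $(\mathcal{A},\cdot)$, $(\mathcal{B},\circ)$ and linear maps $l_{\mathcal A},r_{\mathcal A}:\mathcal{A}\to\mathfrak{gl}(\mathcal{B})$, $l_{\mathcal B},r_{\mathcal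 B}:\mathcal{B}\to\mathfrak{gl}(\mathcal{A})$, the tuple $(\mathcal{A},\mathcal{B},l_{\mathcal A},r_{\mathcal A},l_{\mathcal B},r_{\mathcal B})$ is a matched pair of associative algebras if $(l_{\mathcal A},r_{\mathcal A},\mathcal{B})$ is an $\mathcal{A}$-bimodule, $(l_{\mathcal B},r_{\mathcal B},\mathcal{A})$ is a $\mathcal{B}$-bimodule, and the product $$(x+a)\ast(y+b)=\big(x\cdot y+l_{\mathcal B}(a)y+r_{\mathcal B}(b)x\big)+\big(a\circ b+l_{\mathcal A}(x)b+r_{\mathcal A}(y)a\big)$$ on $\mathcal{A}\oplus\mathcal{B}$ is associative. *)

theory Defs
  imports "HOL-Analysis.Analysis"
begin

section \<open>Associative algebras, bimodules and matched pairs\<close>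

text \<open>Vector spaces are given by a scalar multiplication on a whole type, as in
  \<^locale>\<open>vector_space\<close>; \<open>Vector_Spaces.linear s s'\<close> is linearity over the scalar field
  (and not merely over the reals).\<close>

locale assoc_algebra = vector_space scale
  for scale :: "'k::field \<Rightarrow> 'a::ab_group_add \<Rightarrow> 'a" +
  fixes mult :: "'a \<Rightarrow> 'a \<Rightarrow> 'a"
  assumes linear_mult_right: "Vector_Spaces.linear scale scale (\<lambda>y. mult x y)"
    and linear_mult_left: "Vector_Spaces.linear scale scale (\<lambda>x. mult x y)"
    and mult_assoc: "mult (mult x y) z = mult x (mult y z)"

definition linear_to_gl ::
  "('k::field \<Rightarrow> 'a::ab_group_add \<Rightarrow> 'a) \<Rightarrow> ('k \<Rightarrow> 'v::ab_group_add \<Rightarrow> 'v) \<Rightarrow> ('a \<Rightarrow> 'v \<Rightarrow> 'v) \<Rightarrow> bool" where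
  "linear_to_gl sA sV l \<longleftrightarrow>
     (\<forall>x. Vector_Spaces.linear sV sV (l x)) \<and>
     (\<forall>v. Vector_Spaces.linear sA sV (\<lambda>x. l x v))"

definition bimodule ::
  "('k::field \<Rightarrow> 'a::ab_group_add \<Rightarrow> 'a) \<Rightarrow> ('a \<Rightarrow> 'a \<Rightarrow> 'a) \<Rightarrow> ('k \<Rightarrow> 'v::ab_group_add \<Rightarrow> 'v) \<Rightarrow>
   ('a \<Rightarrow> 'v \<Rightarrow> 'v) \<Rightarrow> ('a \<Rightarrow> 'v \<Rightarrow> 'v) \<Rightarrow> bool" where
  "bimodule sA mA sV l r \<longleftrightarrow>
     linear_to_gl sA sV l \<and> linear_to_gl sA sV r \<and>
     (\<forall>x y. l (mA x y) = l x \<circ> l y) \<and>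
     (\<forall>x y. r (mA x y) = r y \<circ> r x) \<and>
     (\<forall>x y. l x \<circ> r y = r y \<circ> l x)"

fun bicrossed_mult ::
  "('a::ab_group_add \<Rightarrow> 'a \<Rightarrow> 'a) \<Rightarrow> ('b::ab_group_add \<Rightarrow> 'b \<Rightarrow> 'b) \<Rightarrow>
   ('a \<Rightarrow> 'b \<Rightarrow> 'b) \<Rightarrow> ('a \<Rightarrow> 'b \<Rightarrow> 'b) \<Rightarrow> ('b \<Rightarrow> 'a \<Rightarrow> 'a) \<Rightarrow> ('b \<Rightarrow> 'a \<Rightarrow> 'a) \<Rightarrow>
   'a \<times> 'b \<Rightarrow> 'a \<times> 'b \<Rightarrow> 'a \<times> 'b" where
  "bicrossed_mult mA mB lA rA lB rB (x, a) (y, b) =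
     (mA x y + lB a y + rB b x, mB a b + lA x b + rA y a)"

definition matched_pair ::
  "('k::field \<Rightarrow> 'a::ab_group_add \<Rightarrow> 'a) \<Rightarrow> ('a \<Rightarrow> 'a \<Rightarrow> 'a) \<Rightarrow>
   ('k \<Rightarrow> 'b::ab_group_add \<Rightarrow> 'b) \<Rightarrow> ('b \<Rightarrow> 'b \<Rightarrow> 'b) \<Rightarrow>
   ('a \<Rightarrow> 'b \<Rightarrow> 'b) \<Rightarrow> ('a \<Rightarrow> 'b \<Rightarrow> 'b) \<Rightarrow> ('b \<Rightarrow> 'a \<Rightarrow> 'a) \<Rightarrow> ('b \<Rightarrow> 'a \<Rightarrow> 'a) \<Rightarrow> bool" where
  "matched_pair sA mA sB mB lA rA lB rB \<longleftrightarrow>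
     assoc_algebra sA mA \<and> assoc_algebra sB mB \<and>
     bimodule sA mA sB lA rA \<and> bimodule sB mB sA lB rB \<and>
     (let m = bicrossed_mult mA mB lA rA lB rB in \<forall>p q s. m (m p q) s = m p (m q s))"


section \<open>The dual space of a coordinate space\<close>

lemma vector_space_complex: "vector_space ((*) :: complex \<Rightarrow> complex \<Rightarrow> complex)"
  by unfold_locales (auto simp: algebra_simps)

lemma linear_functional_iff:
  "Vector_Spaces.linear ((*s) :: complex \<Rightarrow> complex^'n \<Rightarrow> complex^'n) (*) u \<longleftrightarrow>
   (\<forall>x y. u (x + y) = u x + u y) \<and> (\<forall>c x. u (c *s x) = c * u x)"
  by (simp add: Vector_Spaces.linear_iff vec.vector_space_axioms vector_space_complex)

typedef (overloaded) 'n dual =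
  "{u :: complex^'n::finite \<Rightarrow> complex. Vector_Spaces.linear (*s) (*) u}"
  morphisms dual_apply Abs_dual
  by (rule exI[of _ "\<lambda>_. 0"]) (simp add: linear_functional_iff)

setup_lifting type_definition_dual

instantiation dual :: (finite) ab_group_add
begin

lift_definition zero_dual :: "'a dual" is "\<lambda>_. 0"
  by (simp add: linear_functional_iff)

lift_definition plus_dual :: "'a dual \<Rightarrow> 'a dual \<Rightarrow> 'a dual" is "\<lambda>u v x. u x + v x"
  by (simp add: linear_functional_iff algebra_simps)

lift_definition uminus_dual :: "'a dual \<Rightarrow> 'a dual" is "\<lambda>u x. - u x"
  by (simp add: linear_functional_iff)

lift_definition minus_dual :: "'a dual \<Rightarrow> 'a dual \<Rightarrow> 'a dual" is "\<lambda>u v x. u x - v x"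
  by (simp add: linear_functional_iff algebra_simps)

instance
  by standard (transfer; auto simp: fun_eq_iff algebra_simps)+

end

lift_definition dual_scale :: "complex \<Rightarrow> 'n::finite dual \<Rightarrow> 'n dual" is "\<lambda>c u x. c * u x"
  by (simp add: linear_functional_iff algebra_simps)

lemma vector_space_dual: "vector_space dual_scale"
  by unfold_locales (transfer; auto simp: fun_eq_iff algebra_simps)+

lift_definition dual_basis :: "'n::finite \<Rightarrow> 'n dual" is "\<lambda>i x. x $ i"
  by (simp add: linear_functional_iff)

lemma dual_basis_axis: "dual_apply (dual_basis i) (axis j 1) = of_bool (i = j)"
  by transfer (auto simp: axis_def)

lemma dual_apply_add: "dual_apply u (x + y) = dual_apply u x + dual_apply u y"
  and dual_apply_scale: "dual_apply u (c *s x) = c * dual_apply u x"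
  by (transfer; simp add: linear_functional_iff)+

lemma dual_eqI: "(\<And>x. dual_apply u x = dual_apply v x) \<Longrightarrow> u = v"
  by (simp add: dual_apply_inject[symmetric] fun_eq_iff)

lemma dual_apply_sum: "dual_apply u (\<Sum>i\<in>I. f i) = (\<Sum>i\<in>I. dual_apply u (f i))"
proof (induction I rule: infinite_finite_induct)
  case empty
  show ?case using dual_apply_scale[of u 0 0] by simp
next
  case (infinite I)
  then show ?case using dual_apply_scale[of u 0 0] by simp
qed (simp_all add: dual_apply_add)

lemma dual_apply_expand: "dual_apply u x = (\<Sum>i\<in>UNIV. x $ i * dual_apply u (axis i 1))"
  by (subst basis_expansion[of x, symmetric])
    (simp only: dual_apply_sum dual_apply_scale)

text \<open>The transpose of a linear map (junk if \<open>f\<close> is not linear).\<close>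

definition transpose_map :: "(complex^'m::finite \<Rightarrow> complex^'n::finite) \<Rightarrow> 'n dual \<Rightarrow> 'm dual" where
  "transpose_map f u = Abs_dual (\<lambda>x. dual_apply u (f x))"

lemma dual_apply_transpose_map:
  assumes "Vector_Spaces.linear (*s) (*s) f"
  shows "dual_apply (transpose_map f u) x = dual_apply u (f x)"
  unfolding transpose_map_def using assms
  by (subst Abs_dual_inverse)
    (auto simp: linear_functional_iff Vector_Spaces.linear_iff dual_apply_add dual_apply_scale
      vector_space_complex)


section \<open>Tensor products of coordinate spaces\<close>

text \<open>The tensor product of \<open>complex^'m\<close> and \<open>complex^'n\<close> is modelled on \<open>complex^('m \<times> 'n)\<close>;
  \<open>tensor_universal\<close> below is its universal property.\<close>

definition tensor :: "complex^'m::finite \<Rightarrow> complex^'n::finite \<Rightarrow> complex^('m \<times> 'n)" where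
  "tensor x y = (\<chi> p. x $ fst p * y $ snd p)"

definition tensor_map ::
  "(complex^'m::finite \<Rightarrow> complex^'p::finite) \<Rightarrow> (complex^'n::finite \<Rightarrow> complex^'q::finite) \<Rightarrow>
   complex^('m \<times> 'n) \<Rightarrow> complex^('p \<times> 'q)" where
  "tensor_map f g T = (\<Sum>(i, j)\<in>UNIV. T $ (i, j) *s tensor (f (axis i 1)) (g (axis j 1)))"

text \<open>Dual spaces being finite dimensional, the tensor product of two of them is identified with
  the dual of the tensor product; \<open>dual_tensor u v\<close> is the pure tensor of \<open>u\<close> and \<open>v\<close>
  under this identification, characterised by \<open>dual_tensor_tensor\<close>.\<close>

lift_definition dual_tensor :: "'m::finite dual \<Rightarrow> 'n::finite dual \<Rightarrow> ('m \<times> 'n) dual" is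
  "\<lambda>u v T. \<Sum>(i, j)\<in>UNIV. T $ (i, j) * (u (axis i 1) * v (axis j 1))"
  by (simp add: linear_functional_iff algebra_simps sum.distrib sum_distrib_left split_def)

lemma dual_tensor_tensor: "dual_apply (dual_tensor u v) (tensor x y) = dual_apply u x * dual_apply v y"
proof -
  have "dual_apply (dual_tensor u v) (tensor x y) =
    (\<Sum>(i, j)\<in>UNIV \<times> UNIV. (x $ i * dual_apply u (axis i 1)) * (y $ j * dual_apply v (axis j 1)))"
    by (simp add: dual_tensor.rep_eq tensor_def split_def mult_ac)
  also have "\<dots> = dual_apply u x * dual_apply v y"
    by (simp only: sum_product sum.cartesian_product dual_apply_expand[of u x] dual_apply_expand[of v y])
  finally show ?thesis .
qed

lemma tensor_linear_left: "Vector_Spaces.linear (*s) (*s) (\<lambda>x. tensor x y)"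
  and tensor_linear_right: "Vector_Spaces.linear (*s) (*s) (\<lambda>y. tensor x y)"
  by (auto simp: Vector_Spaces.linear_iff vec.vector_space_axioms tensor_def vec_eq_iff algebra_simps)

lemma tensor_axis: "tensor (axis i 1) (axis j 1) = axis (i, j) 1"
  by (auto simp: tensor_def axis_def vec_eq_iff)

lemma tensor_map_linear: "Vector_Spaces.linear (*s) (*s) (tensor_map f g)"
  unfolding Vector_Spaces.linear_iff tensor_map_def
  by (auto simp: vec.vector_space_axioms split_def sum.distrib vector_sadd_rdistrib
      vec.scale_sum_right vector_smult_assoc)

lemma tensor_universal:
  fixes B :: "complex^'m::finite \<Rightarrow> complex^'n::finite \<Rightarrow> 'v::ab_group_add"
  assumes l: "\<And>y. Vector_Spaces.linear (*s) s (\<lambda>x. B x y)"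
    and r: "\<And>x. Vector_Spaces.linear (*s) s (\<lambda>y. B x y)"
  shows "\<exists>!F. Vector_Spaces.linear (*s) s F \<and> (\<forall>x y. F (tensor x y) = B x y)"
proof -
  interpret S: vector_space s
    using l unfolding Vector_Spaces.linear_iff by blast
  have lin_sum: "G z = (\<Sum>i\<in>UNIV. s (z $ i) (G (axis i 1)))"
    if "Vector_Spaces.linear (*s) s G" for G and z :: "complex^'k::finite"
  proof -
    interpret G: Vector_Spaces.linear "(*s)" s G by fact
    show ?thesis
      by (subst basis_expansion[of z, symmetric]) (simp only: G.sum G.scale)
  qed
  define F where "F T = (\<Sum>p\<in>UNIV. s (T $ p) (B (axis (fst p) 1) (axis (snd p) 1)))"
    for T :: "complex^('m \<times> 'n)"
  have F: "Vector_Spaces.linear (*s) s F"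
    unfolding Vector_Spaces.linear_iff F_def
    by (auto simp: vec.vector_space_axioms S.vector_space_axioms sum.distrib
        S.scale_left_distrib S.scale_sum_right)
  have FB: "F (tensor x y) = B x y" for x y
  proof -
    have "B x y = (\<Sum>i\<in>UNIV. s (x $ i) (\<Sum>j\<in>UNIV. s (y $ j) (B (axis i 1) (axis j 1))))"
      by (subst lin_sum[OF l]) (subst lin_sum[OF r], rule refl)
    also have "\<dots> = (\<Sum>(i, j)\<in>UNIV \<times> UNIV. s (x $ i * y $ j) (B (axis i 1) (axis j 1)))"
      by (simp only: S.scale_sum_right S.scale_scale sum.cartesian_product)
    also have "\<dots> = F (tensor x y)"
      by (simp add: F_def tensor_def split_def)
    finally show ?thesis ..
  qed
  show ?thesis
  proof (rule ex1I[of _ F])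
    show "Vector_Spaces.linear (*s) s F \<and> (\<forall>x y. F (tensor x y) = B x y)"
      using F FB by blast
    fix G assume G: "Vector_Spaces.linear (*s) s G \<and> (\<forall>x y. G (tensor x y) = B x y)"
    show "G = F"
    proof
      fix T
      have "G (axis p 1) = B (axis (fst p) 1) (axis (snd p) 1)" for p
        using G tensor_axis[of "fst p" "snd p"] by (metis prod.collapse)
      then show "G T = F T"
        using lin_sum[of G T] G by (simp add: F_def)
    qed
  qed
qed

lemma tensor_map_tensor:
  assumes f: "Vector_Spaces.linear (*s) (*s) f" and g: "Vector_Spaces.linear (*s) (*s) g"
  shows "tensor_map f g (tensor x y) = tensor (f x) (g y)"
proof -
  interpret f: Vector_Spaces.linear "(*s)" "(*s)" f by fact
  interpret g: Vector_Spaces.linear "(*s)" "(*s)" g by fact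
  have "Vector_Spaces.linear (*s) (*s) (\<lambda>x. tensor (f x) (g y))" for y
    using Vector_Spaces.linear_compose[OF f tensor_linear_left] by (simp add: o_def)
  moreover have "Vector_Spaces.linear (*s) (*s) (\<lambda>y. tensor (f x) (g y))" for x
    using Vector_Spaces.linear_compose[OF g tensor_linear_right] by (simp add: o_def)
  ultimately obtain F where F: "Vector_Spaces.linear (*s) (*s) F"
    and FB: "\<And>x y. F (tensor x y) = tensor (f x) (g y)"
    using tensor_universal[of "(*s)" "\<lambda>x y. tensor (f x) (g y)"] by blast
  interpret F: Vector_Spaces.linear "(*s)" "(*s)" F by fact
  have "F T = tensor_map f g T" for T
  proof -
    have "F T = (\<Sum>p\<in>UNIV. T $ p *s F (axis p 1))"
      by (subst basis_expansion[of T, symmetric]) (simp only: F.sum F.scale)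
    also have "\<dots> = tensor_map f g T"
      by (simp add: tensor_map_def split_def FB[symmetric] tensor_axis)
    finally show ?thesis .
  qed
  then show ?thesis using FB by metis
qed


section \<open>Dual multiplication operators and the coproduct defined by a tensor\<close>

definition L_star :: "(complex^'n::finite \<Rightarrow> complex^'n \<Rightarrow> complex^'n) \<Rightarrow> complex^'n \<Rightarrow> 'n dual \<Rightarrow> 'n dual" where
  "L_star m x = transpose_map (\<lambda>v. m x v)"

definition R_star :: "(complex^'n::finite \<Rightarrow> complex^'n \<Rightarrow> complex^'n) \<Rightarrow> complex^'n \<Rightarrow> 'n dual \<Rightarrow> 'n dual" where
  "R_star m x = transpose_map (\<lambda>v. m v x)"

text \<open>The same operators for a product on the dual space, acting on the original space
  through the identification with its bidual.\<close>

definition L_star_dual :: "('n::finite dual \<Rightarrow> 'n dual \<Rightarrow> 'n dual) \<Rightarrow> 'n dual \<Rightarrow> complex^'n \<Rightarrow> complex^'n" where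
  "L_star_dual m a x = (THE y. \<forall>b. dual_apply b y = dual_apply (m a b) x)"

definition R_star_dual :: "('n::finite dual \<Rightarrow> 'n dual \<Rightarrow> 'n dual) \<Rightarrow> 'n dual \<Rightarrow> complex^'n \<Rightarrow> complex^'n" where
  "R_star_dual m a x = (THE y. \<forall>b. dual_apply b y = dual_apply (m b a) x)"

lemma bidual_ex1:
  assumes "Vector_Spaces.linear dual_scale (*) \<phi>"
  shows "\<exists>!y. \<forall>b. dual_apply b y = \<phi> b"
proof -
  interpret phi: Vector_Spaces.linear dual_scale "(*)" \<phi> by fact
  have expand: "b = (\<Sum>i\<in>UNIV. dual_scale (dual_apply b (axis i 1)) (dual_basis i))" for b :: "'a dual"
  proof (rule dual_eqI)
    fix x
    have app: "dual_apply (\<Sum>i\<in>I. f i) x = (\<Sum>i\<in>I. dual_apply (f i) x)"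
      for I :: "'a set" and f :: "'a \<Rightarrow> 'a dual"
      by (induction I rule: infinite_finite_induct) (simp_all add: zero_dual.rep_eq plus_dual.rep_eq)
    show "dual_apply b x =
      dual_apply (\<Sum>i\<in>UNIV. dual_scale (dual_apply b (axis i 1)) (dual_basis i)) x"
      by (subst dual_apply_expand) (simp add: app dual_scale.rep_eq dual_basis.rep_eq mult.commute)
  qed
  show ?thesis
  proof (rule ex1I[of _ "\<chi> i. \<phi> (dual_basis i)"])
    have "\<phi> b = dual_apply b (\<chi> i. \<phi> (dual_basis i))" for b
    proof -
      have "\<phi> b = (\<Sum>i\<in>UNIV. dual_apply b (axis i 1) * \<phi> (dual_basis i))"
        by (subst expand[of b]) (simp only: phi.sum phi.scale)
      also have "\<dots> = dual_apply b (\<chi> i. \<phi> (dual_basis i))"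
        by (subst dual_apply_expand[of b "\<chi> i. \<phi> (dual_basis i)"]) (simp add: mult.commute)
      finally show ?thesis .
    qed
    then show "\<forall>b. dual_apply b (\<chi> i. \<phi> (dual_basis i)) = \<phi> b"
      by (intro allI) (rule sym)
  next
    fix y assume "\<forall>b. dual_apply b y = \<phi> b"
    then have "dual_apply (dual_basis i) y = \<phi> (dual_basis i)" for i by blast
    then show "y = (\<chi> i. \<phi> (dual_basis i))"
      by (simp add: vec_eq_iff dual_basis.rep_eq)
  qed
qed

lemma dual_apply_dual: "Vector_Spaces.linear dual_scale (*) (\<lambda>b. dual_apply b x)"
  by (simp add: Vector_Spaces.linear_iff vector_space_dual vector_space_complex
      plus_dual.rep_eq dual_scale.rep_eq)

lemma dual_apply_L_star_dual:
  assumes "Vector_Spaces.linear dual_scale dual_scale (\<lambda>b. m a b)"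
  shows "dual_apply b (L_star_dual m a x) = dual_apply (m a b) x"
proof -
  have "Vector_Spaces.linear dual_scale (*) (\<lambda>b. dual_apply (m a b) x)"
    using Vector_Spaces.linear_compose[OF assms dual_apply_dual] by (simp add: o_def)
  from theI'[OF bidual_ex1[OF this]] show ?thesis
    unfolding L_star_dual_def by blast
qed

lemma dual_apply_R_star_dual:
  assumes "Vector_Spaces.linear dual_scale dual_scale (\<lambda>b. m b a)"
  shows "dual_apply b (R_star_dual m a x) = dual_apply (m b a) x"
proof -
  have "Vector_Spaces.linear dual_scale (*) (\<lambda>b. dual_apply (m b a) x)"
    using Vector_Spaces.linear_compose[OF assms dual_apply_dual] by (simp add: o_def)
  from theI'[OF bidual_ex1[OF this]] show ?thesis
    unfolding R_star_dual_def by blast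
qed

definition coproduct_of ::
  "(complex^'n::finite \<Rightarrow> complex^'n \<Rightarrow> complex^'n) \<Rightarrow> complex^('n \<times> 'n) \<Rightarrow> complex^'n \<Rightarrow> complex^('n \<times> 'n)" where
  "coproduct_of m r x = tensor_map id (\<lambda>y. m x y) r - tensor_map (\<lambda>y. m y x) id r"

definition dual_product :: "(complex^'n::finite \<Rightarrow> complex^('n \<times> 'n)) \<Rightarrow> 'n dual \<Rightarrow> 'n dual \<Rightarrow> 'n dual" where
  "dual_product \<Delta> a b = transpose_map \<Delta> (dual_tensor a b)"


section \<open>The algebra H\<close>

text \<open>The standard basis vectors \<open>axis 1 1\<close>, \<open>axis 2 1\<close>, \<open>axis 3 1\<close> are the basis of the algebra,
  and the product is the bilinear extension of the table \<open>H_mult_axis\<close>. The numeral type \<open>3\<close> serves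
  as index set; its element \<open>3\<close> equals \<open>0\<close>, so that the indices 1, 2, 3 are distinct and exhaust
  it.\<close>

definition H_mult :: "complex \<Rightarrow> complex^3 \<Rightarrow> complex^3 \<Rightarrow> complex^3" where
  "H_mult \<alpha> x y = (x $ 1 * y $ 3 + \<alpha> * (x $ 3 * y $ 1)) *s axis 2 1"

lemma H_mult_axis:
  "H_mult \<alpha> (axis i 1) (axis j 1) =
     (if i = 1 \<and> j = 3 then axis 2 1 else if i = 3 \<and> j = 1 then \<alpha> *s axis 2 1 else 0)"
  by (auto simp: H_mult_def axis_def vec_eq_iff)

lemma assoc_algebra_H: "assoc_algebra (*s) (H_mult \<alpha>)"
  by unfold_locales (auto simp: H_mult_def vec_eq_iff axis_def algebra_simps)

lemma coproduct_of_H_linear: "Vector_Spaces.linear (*s) (*s) (coproduct_of (H_mult \<alpha>) r)"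
proof -
  have "H_mult \<alpha> (x + y) z = H_mult \<alpha> x z + H_mult \<alpha> y z"
    "H_mult \<alpha> z (x + y) = H_mult \<alpha> z x + H_mult \<alpha> z y"
    "H_mult \<alpha> (c *s x) z = c *s H_mult \<alpha> x z"
    "H_mult \<alpha> z (c *s x) = c *s H_mult \<alpha> z x" for x y z c
    by (auto simp: H_mult_def vec_eq_iff algebra_simps)
  then show ?thesis
    by (auto simp: Vector_Spaces.linear_iff vec.vector_space_axioms coproduct_of_def tensor_map_def
        tensor_def vec_eq_iff sum.distrib[symmetric] sum_subtractf[symmetric] sum_distrib_left
        split_def algebra_simps)
qed

end

theory Submission
  imports Defs
begin

text \<open>Each coproduct has the form \<open>\<Delta> x = k x\<^sub>w e\<^sub>2 \<otimes> e\<^sub>2\<close> with \<open>w \<in> {1, 3}\<close>.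
  Hence in the bicrossed product on \<open>H \<oplus> H\<^sup>*\<close> a product \<open>(x, a) * (y, b)\<close> depends only on the
  coordinates 1, 3 of \<open>x\<close>, \<open>y\<close> and the coordinate 2 of \<open>a\<close>, \<open>b\<close>, whereas these coordinates of its
  value vanish. All triple products are therefore zero, and associativity is trivial.\<close>

text \<open>The coordinate functionals already separate points. This recovers the vectors that
  \<open>L_star_dual\<close> and \<open>R_star_dual\<close> specify only through their
  pairings.\<close>

lemma dual_apply_separates:
  assumes "\<And>b. dual_apply b x = dual_apply b y"
  shows "x = y"
  using assms[of "dual_basis i" for i] by (simp add: vec_eq_iff dual_basis.rep_eq)

lemma linear_H_mult:
  "Vector_Spaces.linear (*s) (*s) (\<lambda>y. H_mult \<alpha> x y)"
  "Vector_Spaces.linear (*s) (*s) (\<lambda>x. H_mult \<alpha> x y)"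
  using assoc_algebra_H[of \<alpha>] by (simp_all add: assoc_algebra_def assoc_algebra_axioms_def)

text \<open>Bilinearity of \<open>m\<close> makes both factors of each \<open>tensor_map\<close>
  linear, so the coproduct of an antisymmetric tensor can be computed on pure tensors.\<close>

lemma coproduct_of_tensor_diff:
  assumes "\<And>y. Vector_Spaces.linear (*s) (*s) (\<lambda>x. m x y)"
    and "\<And>x. Vector_Spaces.linear (*s) (*s) (\<lambda>y. m x y)"
  shows "coproduct_of m (a *s (tensor u v - tensor v u)) x =
    a *s (tensor u (m x v) - tensor v (m x u) - tensor (m u x) v + tensor (m v x) u)"
proof -
  have id: "Vector_Spaces.linear (*s) (*s) (id :: complex^'a \<Rightarrow> complex^'a)"
    by (simp add: Vector_Spaces.linear_iff vec.vector_space_axioms)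
  have expand: "tensor_map f g (a *s (tensor u v - tensor v u)) =
      a *s (tensor (f u) (g v) - tensor (f v) (g u))"
    if "Vector_Spaces.linear (*s) (*s) f" "Vector_Spaces.linear (*s) (*s) g"
    for f g :: "complex^'a \<Rightarrow> complex^'a"
  proof -
    interpret T: Vector_Spaces.linear "(*s)" "(*s)" "tensor_map f g"
      by (rule tensor_map_linear)
    show ?thesis by (simp only: T.scale T.diff tensor_map_tensor[OF that])
  qed
  show ?thesis
    unfolding coproduct_of_def expand[OF id assms(2)] expand[OF assms(1) id]
    by (simp add: vec_eq_iff algebra_simps)
qed

text \<open>As \<open>axis 2 1\<close> annihilates the algebra from both sides, only the terms with
  x e_1 = \<alpha> x_3 e_2 and e_1 x = x_3 e_2 survive, both with a minus sign.\<close>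

lemma coproduct_of_H_12:
  "coproduct_of (H_mult \<alpha>) (a *s (tensor (axis 1 1) (axis 2 1) - tensor (axis 2 1) (axis 1 1))) x =
    (- ((\<alpha> + 1) * a) * x $ 3) *s tensor (axis 2 1) (axis 2 1)"
  unfolding coproduct_of_tensor_diff[OF linear_H_mult(2,1)]
  by (auto simp: H_mult_def tensor_def axis_def vec_eq_iff algebra_simps)

text \<open>Here the surviving terms come from x e_3 = x_1 e_2 and e_3 x = \<alpha> x_1 e_2, both
  with a plus sign.\<close>

lemma coproduct_of_H_23:
  "coproduct_of (H_mult \<alpha>) (a *s (tensor (axis 2 1) (axis 3 1) - tensor (axis 3 1) (axis 2 1))) x =
    ((\<alpha> + 1) * a * x $ 1) *s tensor (axis 2 1) (axis 2 1)"
  unfolding coproduct_of_tensor_diff[OF linear_H_mult(2,1)]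
  by (auto simp: H_mult_def tensor_def axis_def vec_eq_iff algebra_simps)

text \<open>Transposing a map of rank at most one: the pairing with the fixed pure tensor splits
  into two evaluations, and the coordinate \<open>x $ w\<close> turns into
  \<open>dual_basis w\<close>.\<close>

lemma dual_product_coproduct_H:
  assumes "\<And>x. coproduct_of (H_mult \<alpha>) r x = (k * x $ w) *s tensor (axis i 1) (axis j 1)"
  shows "dual_product (coproduct_of (H_mult \<alpha>) r) u v =
    dual_scale (k * dual_apply u (axis i 1) * dual_apply v (axis j 1)) (dual_basis w)"
  by (rule dual_eqI)
    (simp add: dual_product_def dual_apply_transpose_map[OF coproduct_of_H_linear] assms
      dual_apply_scale dual_tensor_tensor dual_scale.rep_eq dual_basis.rep_eq)

lemmas dual_rep_eqs = plus_dual.rep_eq dual_scale.rep_eq dual_basis.rep_eq zero_dual.rep_eq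

text \<open>All products in the algebra are multiples of \<open>axis 2 1\<close>, so
  \<open>u\<close> enters only through its value there. The resulting functional itself vanishes at
  \<open>axis 2 1\<close>.\<close>

lemma R_star_H: "R_star (H_mult \<alpha>) x u =
    dual_scale (dual_apply u (axis 2 1)) (dual_scale (x $ 3) (dual_basis 1) + dual_scale (\<alpha> * x $ 1) (dual_basis 3))"
  by (rule dual_eqI)
    (simp only: R_star_def dual_apply_transpose_map[OF linear_H_mult(2)],
      simp add: H_mult_def dual_apply_add dual_apply_scale dual_rep_eqs algebra_simps)

lemma L_star_H: "L_star (H_mult \<alpha>) x u =
    dual_scale (dual_apply u (axis 2 1)) (dual_scale (x $ 1) (dual_basis 3) + dual_scale (\<alpha> * x $ 3) (dual_basis 1))"
  by (rule dual_eqI)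
    (simp only: L_star_def dual_apply_transpose_map[OF linear_H_mult(1)],
      simp add: H_mult_def dual_apply_add dual_apply_scale dual_rep_eqs algebra_simps)

text \<open>Common form of both dual products: \<open>w\<close> is 3 for \<open>r1\<close> and 1 for
  \<open>r2\<close>. Since \<open>w \<noteq> 2\<close>, \<open>dual_basis w\<close> vanishes at
  \<open>axis 2 1\<close>, so \<open>m\<close> is zero as soon as one argument is a value of
  \<open>m\<close>.\<close>

context
  fixes m :: "3 dual \<Rightarrow> 3 dual \<Rightarrow> 3 dual" and k :: complex and w :: 3
  assumes m: "\<And>u v. m u v =
      dual_scale (k * dual_apply u (axis 2 1) * dual_apply v (axis 2 1)) (dual_basis w)"
    and w: "w \<noteq> 2"
begin

lemma linear_rank_one_product:
  "Vector_Spaces.linear dual_scale dual_scale (\<lambda>b. m a b)"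
  "Vector_Spaces.linear dual_scale dual_scale (\<lambda>b. m b a)"
  by (auto simp: Vector_Spaces.linear_iff vector_space_dual m dual_rep_eqs algebra_simps
      intro!: dual_eqI)

lemma assoc_algebra_rank_one_product: "assoc_algebra dual_scale m"
  unfolding assoc_algebra_def assoc_algebra_axioms_def
  using w by (simp add: vector_space_dual linear_rank_one_product)
    (simp add: m dual_rep_eqs axis_def)

lemma L_star_dual_rank_one_product:
  "L_star_dual m a x = (k * dual_apply a (axis 2 1) * x $ w) *s axis 2 1"
  by (rule dual_apply_separates)
    (simp add: dual_apply_L_star_dual linear_rank_one_product dual_apply_scale, simp add: m dual_rep_eqs)

text \<open>The formula agrees with that for \<open>L_star_dual\<close> because \<open>m\<close> is
  commutative.\<close>

lemma R_star_dual_rank_one_product: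
  "R_star_dual m a x = (k * dual_apply a (axis 2 1) * x $ w) *s axis 2 1"
  by (rule dual_apply_separates)
    (simp add: dual_apply_R_star_dual linear_rank_one_product dual_apply_scale, simp add: m dual_rep_eqs)

lemma matched_pair_rank_one_product:
  "matched_pair (*s) (H_mult \<alpha>) dual_scale m
    (R_star (H_mult \<alpha>)) (L_star (H_mult \<alpha>)) (R_star_dual m) (L_star_dual m)"
proof -
  \<comment> \<open>Both sides of each bimodule law are zero: a product has zero coordinates 1 and
    3, and the image of each operator consists of functionals vanishing at
    \<open>axis 2 1\<close>.\<close>
  have A: "bimodule (*s) (H_mult \<alpha>) dual_scale (R_star (H_mult \<alpha>)) (L_star (H_mult \<alpha>))"
    unfolding bimodule_def linear_to_gl_def Vector_Spaces.linear_iff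
    by (auto simp: vector_space_dual vec.vector_space_axioms R_star_H L_star_H fun_eq_iff
        dual_rep_eqs H_mult_def algebra_simps axis_def intro!: dual_eqI)
  \<comment> \<open>Again everything vanishes, now because the operators map into multiples of
    \<open>axis 2 1\<close>, whose coordinate \<open>w\<close> is zero.\<close>
  have B: "bimodule dual_scale m (*s) (R_star_dual m) (L_star_dual m)"
    unfolding bimodule_def linear_to_gl_def Vector_Spaces.linear_iff
    using w
    by (auto simp: vector_space_dual vec.vector_space_axioms R_star_dual_rank_one_product
        L_star_dual_rank_one_product m fun_eq_iff dual_rep_eqs vec_eq_iff algebra_simps axis_def)
  have C: "let n = bicrossed_mult (H_mult \<alpha>) m (R_star (H_mult \<alpha>)) (L_star (H_mult \<alpha>))
      (R_star_dual m) (L_star_dual m) in \<forall>p q s. n (n p q) s = n p (n q s)"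
    using w
    by (auto simp: Let_def R_star_H L_star_H R_star_dual_rank_one_product
        L_star_dual_rank_one_product m H_mult_def dual_rep_eqs vec_eq_iff axis_def intro!: dual_eqI)
  show ?thesis
    unfolding matched_pair_def
    using assoc_algebra_H assoc_algebra_rank_one_product A B C by blast
qed

end

theorem corollary3p8:
  fixes \<alpha> a12 a23 :: complex and r1 r2 :: "complex^(3 \<times> 3)"
  assumes "\<alpha> \<noteq> 1"
    and "r1 = a12 *s (tensor (axis 1 1) (axis 2 1) - tensor (axis 2 1) (axis 1 1))"
    and "r2 = a23 *s (tensor (axis 2 1) (axis 3 1) - tensor (axis 3 1) (axis 2 1))"
  shows
    "(\<forall>r \<in> {r1, r2}. assoc_algebra dual_scale (dual_product (coproduct_of (H_mult \<alpha>) r))) \<and>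
     (\<forall>i j. dual_product (coproduct_of (H_mult \<alpha>) r1) (dual_basis i) (dual_basis j) =
        dual_scale (- (of_bool (i = 2) * of_bool (j = 2) * (\<alpha> + 1) * a12)) (dual_basis 3)) \<and>
     (\<forall>i j. dual_product (coproduct_of (H_mult \<alpha>) r2) (dual_basis i) (dual_basis j) =
        dual_scale (of_bool (i = 2) * of_bool (j = 2) * (\<alpha> + 1) * a23) (dual_basis 1)) \<and>
     (\<forall>r \<in> {r1, r2}. let m = dual_product (coproduct_of (H_mult \<alpha>) r) in
        matched_pair (*s) (H_mult \<alpha>) dual_scale m
          (R_star (H_mult \<alpha>)) (L_star (H_mult \<alpha>)) (R_star_dual m) (L_star_dual m))"
proof -
  have m1: "dual_product (coproduct_of (H_mult \<alpha>) r1) u v =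
      dual_scale (- ((\<alpha> + 1) * a12) * dual_apply u (axis 2 1) * dual_apply v (axis 2 1)) (dual_basis 3)"
    for u v
    using assms(2) by (intro dual_product_coproduct_H) (simp only: coproduct_of_H_12)
  have m2: "dual_product (coproduct_of (H_mult \<alpha>) r2) u v =
      dual_scale ((\<alpha> + 1) * a23 * dual_apply u (axis 2 1) * dual_apply v (axis 2 1)) (dual_basis 1)"
    for u v
    using assms(3) by (intro dual_product_coproduct_H) (simp only: coproduct_of_H_23)
  have w: "(3::3) \<noteq> 2" "(1::3) \<noteq> 2" by simp_all
  note first = assoc_algebra_rank_one_product[OF m1 w(1)] matched_pair_rank_one_product[OF m1 w(1)]
  note second = assoc_algebra_rank_one_product[OF m2 w(2)] matched_pair_rank_one_product[OF m2 w(2)]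
  show ?thesis
    unfolding Let_def
  proof (intro conjI)
    show "\<forall>i j. dual_product (coproduct_of (H_mult \<alpha>) r1) (dual_basis i) (dual_basis j) =
        dual_scale (- (of_bool (i = 2) * of_bool (j = 2) * (\<alpha> + 1) * a12)) (dual_basis 3)"
      and "\<forall>i j. dual_product (coproduct_of (H_mult \<alpha>) r2) (dual_basis i) (dual_basis j) =
        dual_scale (of_bool (i = 2) * of_bool (j = 2) * (\<alpha> + 1) * a23) (dual_basis 1)"
      \<comment> \<open>Evaluating the two dual basis vectors at \<open>axis 2 1\<close> produces
        the Kronecker deltas.\<close>
      by (simp_all add: m1 m2 dual_basis_axis)
  qed (use first second in blast)+
qed

end
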